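(* Let $\mathcal{C}\subset\mathbb{R}^2$ be a homothetic soliton curve for the inverse curve shortening flow with constant $c\in\mathbb{R}\setminus\{0\}$. Then there exist constants $\mu_1,\mu_2\in\mathbb{R}$ such that $\mathcal{C}$ admits a parametrization $(x(\theta),y(\theta))$, with $\theta$ ranging over an interval, given explicitly as follows. (1) If $c<0$ or $0<c<1$, set $\alpha=\sqrt{1-c}$; then \[ \begin{cases} x(\theta)=\alpha\left[\mu_1\sin(\alpha\theta)-\mu_2\cos(\alpha\theta)\right]\cos\theta-\left[\mu_1\cos(\alpha\theta)+\mu_2\sin(\alpha\theta)\right]\sin\theta,\\ y(\theta)=\alpha\left[\mu_1\sin(\alpha\theta)-\mu_2\cos(\alpha\theta)\right]\sin\theta+\left[\mu_1\cos(\alpha\theta)+\mu_2\sin(\alpha\theta)\right]\cos\theta. \end{cases} \] (2) If $c=1$, then \[ \begin{cases} x(\theta)=-\mu_2\cos\theta-(\mu_1+\mu_2\theta)\sin\theta,\\ y(\theta)=-\mu_2\sin\theta+(\mu_1+\mu_2\theta)\cos\theta. \end{cases} \] (3) If $c>1$, set $\alpha=\sqrt{c-1}$; then \[ \begin{cases} x(\theta)=-\alpha\left[\mu_1\sinh(\alpha\theta)+\mu_2\cosh(\alpha\theta)\right]\cos\theta-\left[\mu_1\cosh(\alpha\theta)+\mu_2\sinh(\alpha\theta)\right]\sin\theta,\\ y(\theta)=-\alpha\left[\mu_1\sinh(\alpha\theta)+\mu_2\cosh(\alpha\theta)\right]\sin\theta+\left[\mu_1\cosh(\alpha\theta)+\mu_2\sinh(\alpha\theta)\right]\cos\theta.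 \end{cases} \]
   Context: A curve is a smooth connected regular (immersed) curve in $\mathbb{R}^2$ with position vector $X$. Its curvature vector is $\overrightarrow{\kappa}=\frac{d^2X}{ds^2}$, where $s$ is arc length. A curve with nowhere vanishing curvature vector is called a homothetic soliton curve for the inverse curve shortening flow (the one-dimensional inverse mean curvature flow) with constant $c\in\mathbb{R}\setminus\{0\}$ if \[ -\frac{1}{|\overrightarrow{\kappa}|^2}\overrightarrow{\kappa}=c\,X^{\perp} \] along the curve, where $X^\perp$ is the component of the position vector $X$ normal to the curve. *)

theory Defs
  imports "HOL-Analysis.Analysis"
begin

definition nondegenerate_interval :: "real set \<Rightarrow> bool" where
  "nondegenerate_interval I \<longleftrightarrow> is_interval I \<and> (\<exists>a\<in>I. \<exists>b\<in>I. a < b)"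

(* One-sided at those endpoints of I that belong to I; the ordinary derivative in the interior. *)
definition deriv_on :: "real set \<Rightarrow> (real \<Rightarrow> 'a::real_normed_vector) \<Rightarrow> real \<Rightarrow> 'a" where
  "deriv_on I f t = vector_derivative f (at t within I)"

definition smooth_on :: "real set \<Rightarrow> (real \<Rightarrow> 'a::real_normed_vector) \<Rightarrow> bool" where
  "smooth_on I f \<longleftrightarrow> (\<forall>n. (deriv_on I ^^ n) f differentiable_on I)"

(* A connected immersed curve is given by a regular parametrization X on an interval I, which is
   not required to be injective, open or bounded. Closed curves are periodic maps on the whole line. *)
definition regular_curve :: "real set \<Rightarrow> (real \<Rightarrow> real^2) \<Rightarrow> bool" where
  "regular_curve I X \<longleftrightarrow>
     nondegenerate_interval I \<and> smooth_on I X \<and> (\<forall>t\<in>I. deriv_on I X t \<noteq> 0)"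

(* The operator d/ds along X, where ds/dt = norm (dX/dt). *)
definition arclength_deriv ::
    "real set \<Rightarrow> (real \<Rightarrow> real^2) \<Rightarrow> (real \<Rightarrow> real^2) \<Rightarrow> real \<Rightarrow> real^2" where
  "arclength_deriv I X f t = (1 / norm (deriv_on I X t)) *\<^sub>R deriv_on I f t"

definition unit_tangent :: "real set \<Rightarrow> (real \<Rightarrow> real^2) \<Rightarrow> real \<Rightarrow> real^2" where
  "unit_tangent I X = arclength_deriv I X X"

definition curvature_vector :: "real set \<Rightarrow> (real \<Rightarrow> real^2) \<Rightarrow> real \<Rightarrow> real^2" where
  "curvature_vector I X = arclength_deriv I X (arclength_deriv I X X)"

definition normal_component :: "real set \<Rightarrow> (real \<Rightarrow> real^2) \<Rightarrow> real \<Rightarrow> real^2" where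
  "normal_component I X t = X t - (X t \<bullet> unit_tangent I X t) *\<^sub>R unit_tangent I X t"

definition homothetic_soliton :: "real \<Rightarrow> real set \<Rightarrow> (real \<Rightarrow> real^2) \<Rightarrow> bool" where
  "homothetic_soliton c I X \<longleftrightarrow>
     c \<noteq> 0 \<and> regular_curve I X \<and>
     (\<forall>t\<in>I. curvature_vector I X t \<noteq> 0) \<and>
     (\<forall>t\<in>I. - ((1 / (norm (curvature_vector I X t))\<^sup>2) *\<^sub>R curvature_vector I X t)
             = c *\<^sub>R normal_component I X t)"

definition diffeo_between :: "real set \<Rightarrow> real set \<Rightarrow> (real \<Rightarrow> real) \<Rightarrow> bool" where
  "diffeo_between I J \<phi> \<longleftrightarrow>
     bij_betw \<phi> I J \<and> smooth_on I \<phi> \<and> smooth_on J (inv_into I \<phi>)"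

(* The curve X on I is traced out by Y on some interval J, up to a change of parameter
   (orientation preserving or reversing). *)
definition admits_parametrization ::
    "real set \<Rightarrow> (real \<Rightarrow> real^2) \<Rightarrow> (real \<Rightarrow> real^2) \<Rightarrow> bool" where
  "admits_parametrization I X Y \<longleftrightarrow>
     (\<exists>J \<phi>. nondegenerate_interval J \<and> diffeo_between I J \<phi> \<and> (\<forall>t\<in>I. X t = Y (\<phi> t)))"

end

(* Parametrize the curve by its tangent angle phi and split the position vector as X = q T + p N.
   With omega = phi', which is the signed curvature times |X'|, the Frenet equations are
   p' = - omega q and q' = omega p + |X'|. The soliton equation says |X'| = - c p omega, so with
   respect to phi the pair satisfies dp/dphi = - q, dq/dphi = (1 - c) p. Hence p solves
   p'' + (1 - c) p = 0, and the sign of 1 - c separates the three cases. Since omega does not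
   vanish, phi is a diffeomorphism onto its image. *)

theory Submission
  imports Defs
begin

section \<open>Smooth real functions on an interval\<close>

text \<open>Each level asks only for some derivative as a witness, so closure under sums, products
  and compositions follows by induction without evaluating \<open>deriv_on\<close>. Holding for all
  \<open>n\<close>, it agrees with \<open>smooth_on\<close> for real functions on nondegenerate
  intervals.\<close>

primrec times_diff :: "nat \<Rightarrow> real set \<Rightarrow> (real \<Rightarrow> real) \<Rightarrow> bool" where
  "times_diff 0 I f \<longleftrightarrow> True"
| "times_diff (Suc n) I f \<longleftrightarrow>
     (\<exists>f'. (\<forall>t\<in>I. (f has_real_derivative f' t) (at t within I)) \<and> times_diff n I f')"

lemma times_diffI:
  "(\<And>t. t \<in> I \<Longrightarrow> (f has_real_derivative f' t) (at t within I)) \<Longrightarrow> times_diff n I f' \<Longrightarrow>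
     times_diff (Suc n) I f"
  by auto

lemma times_diff_cong:
  "times_diff n I f \<Longrightarrow> (\<And>t. t \<in> I \<Longrightarrow> f t = g t) \<Longrightarrow> times_diff n I g"
proof (cases n)
  case (Suc m)
  assume f: "times_diff n I f" and eq: "\<And>t. t \<in> I \<Longrightarrow> f t = g t"
  obtain f' where f': "\<forall>t\<in>I. (f has_real_derivative f' t) (at t within I)" "times_diff m I f'"
    using f Suc by auto
  have "(g has_real_derivative f' t) (at t within I)" if "t \<in> I" for t
    using has_field_derivative_transform_within[OF f'(1)[rule_format, OF that] zero_less_one that]
      eq by auto
  then show ?thesis
    using f'(2) Suc by auto
qed simp

lemma times_diff_Suc_D: "times_diff (Suc n) I f \<Longrightarrow> times_diff n I f"
proof (induction n arbitrary: f)
  case (Suc n)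
  then show ?case
    by (metis times_diff.simps(2))
qed simp

lemma times_diff_const: "times_diff n I (\<lambda>_. k)"
proof (induction n arbitrary: k)
  case (Suc n)
  show ?case
    by (rule times_diffI[OF _ Suc[of 0]]) (auto intro!: derivative_eq_intros)
qed simp

lemma times_diff_add:
  "times_diff n I f \<Longrightarrow> times_diff n I g \<Longrightarrow> times_diff n I (\<lambda>t. f t + g t)"
proof (induction n arbitrary: f g)
  case (Suc n)
  then obtain f' g' where
    "\<forall>t\<in>I. (f has_real_derivative f' t) (at t within I)" "times_diff n I f'"
    "\<forall>t\<in>I. (g has_real_derivative g' t) (at t within I)" "times_diff n I g'"
    by auto
  then show ?case
    by (intro times_diffI[where f' = "\<lambda>t. f' t + g' t"] Suc.IH) (auto intro!: derivative_intros)
qed simp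

lemma times_diff_mult:
  "times_diff n I f \<Longrightarrow> times_diff n I g \<Longrightarrow> times_diff n I (\<lambda>t. f t * g t)"
proof (induction n arbitrary: f g)
  case (Suc n)
  then obtain f' g' where
    d: "\<forall>t\<in>I. (f has_real_derivative f' t) (at t within I)" "times_diff n I f'"
    "\<forall>t\<in>I. (g has_real_derivative g' t) (at t within I)" "times_diff n I g'"
    by auto
  have "times_diff n I (\<lambda>t. f' t * g t + f t * g' t)"
    using Suc.prems[THEN times_diff_Suc_D] d by (intro times_diff_add Suc.IH)
  then show ?case
    using d by (intro times_diffI[where f' = "\<lambda>t. f' t * g t + f t * g' t"])
      (auto intro!: derivative_eq_intros)
qed simp

lemma times_diff_minus: "times_diff n I f \<Longrightarrow> times_diff n I (\<lambda>t. - f t)"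
  using times_diff_mult[OF times_diff_const[of n I "-1"]] by fastforce

text \<open>The derivative of 1/f is -(1/f) f' (1/f), so order \<open>n\<close> for 1/f yields order
  \<open>n + 1\<close>. Assuming all orders of \<open>f\<close> at once leaves only 1/f to the
  induction.\<close>

lemma times_diff_inverse:
  assumes "\<And>n. times_diff n I f" and nz: "\<And>t. t \<in> I \<Longrightarrow> f t \<noteq> 0"
  shows "times_diff n I (\<lambda>t. inverse (f t))"
proof (induction n)
  case (Suc n)
  obtain f' where
    d: "\<forall>t\<in>I. (f has_real_derivative f' t) (at t within I)" "times_diff n I f'"
    using assms(1)[of "Suc n"] by auto
  have "times_diff n I (\<lambda>t. - (inverse (f t) * f' t * inverse (f t)))"
    using d Suc by (intro times_diff_minus times_diff_mult)
  then show ?case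
    using d nz by (intro times_diffI[where f' = "\<lambda>t. - (inverse (f t) * f' t * inverse (f t))"])
      (auto intro!: derivative_eq_intros)
qed simp

lemma times_diff_compose:
  "times_diff n J f \<Longrightarrow> times_diff n I g \<Longrightarrow> g ` I \<subseteq> J \<Longrightarrow> times_diff n I (\<lambda>t. f (g t))"
proof (induction n arbitrary: f)
  case (Suc n)
  then obtain f' g' where
    d: "\<forall>t\<in>J. (f has_real_derivative f' t) (at t within J)" "times_diff n J f'"
    "\<forall>t\<in>I. (g has_real_derivative g' t) (at t within I)" "times_diff n I g'"
    by auto
  have *: "times_diff n I (\<lambda>t. f' (g t) * g' t)"
    using times_diff_mult[OF Suc.IH[OF d(2) times_diff_Suc_D[OF Suc.prems(2)] Suc.prems(3)] d(4)] .
  have "((\<lambda>t. f (g t)) has_real_derivative f' (g t) * g' t) (at t within I)" if "t \<in> I" for t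
  proof -
    have "(f has_real_derivative f' (g t)) (at (g t) within g ` I)"
      using d(1) that Suc.prems(3) by (meson DERIV_subset image_subset_iff)
    from DERIV_image_chain[OF this d(3)[rule_format, OF that]] show ?thesis
      by (simp add: o_def)
  qed
  then show ?case
    by (rule times_diffI[OF _ *])
qed simp

text \<open>Bootstrapping: the derivative of the inverse is 1/f' composed with the inverse itself,
  so each order of the inverse gives the next one.\<close>

lemma times_diff_inv_into:
  assumes d: "\<And>t. t \<in> I \<Longrightarrow> (f has_real_derivative f' t) (at t within I)"
    and f': "\<And>n. times_diff n I f'" and nz: "\<And>t. t \<in> I \<Longrightarrow> f' t \<noteq> 0"
    and I: "is_interval I" and inj: "inj_on f I"
  shows "times_diff n (f ` I) (inv_into I f)"
proof -
  let ?g = "inv_into I f"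
  have cf: "continuous_on I f"
    by (rule DERIV_continuous_on[OF d])
  have "path_connected I"
    using I by (simp add: convex_imp_path_connected is_interval_convex)
  \<comment> \<open>A continuous injection of an interval is a homeomorphism onto its image. This
    gives the continuity of the inverse on which the derivative rule for inverses rests.\<close>
  with injective_into_1d_eq_homeomorphism[OF cf] inj
  obtain g where g: "homeomorphism I (f ` I) f g"
    by blast
  have "continuous_on (f ` I) ?g"
  proof (rule continuous_on_eq)
    show "continuous_on (f ` I) g"
      using g by (simp add: homeomorphism_def)
    show "g x = ?g x" if "x \<in> f ` I" for x
      using that g inj by (auto simp: homeomorphism_def)
  qed
  then have cg: "continuous (at (f t) within f ` I) ?g" if "t \<in> I" for t
    using that continuous_on_eq_continuous_within by blast
  have D: "(?g has_real_derivative inverse (f' (?g s))) (at s within f ` I)" if s: "s \<in> f ` I" for s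
  proof -
    obtain t where t: "t \<in> I" "s = f t"
      using s by blast
    have "(?g has_derivative (*) (inverse (f' t))) (at (f t) within f ` I)"
    proof (rule has_derivative_inverse_within)
      show "(f has_derivative (*) (f' t)) (at t within I)"
        using d[OF t(1)] by (simp add: has_field_derivative_def)
      show "linear ((*) (inverse (f' t)))"
        by (simp add: linear_times)
      show "(*) (inverse (f' t)) \<circ> (*) (f' t) = id"
        using nz[OF t(1)] by (auto simp: fun_eq_iff field_simps)
    qed (use t cg inj in auto)
    then show ?thesis
      using t inj by (simp add: has_field_derivative_def)
  qed
  show ?thesis
  proof (induction n)
    case (Suc n)
    have "times_diff n I (\<lambda>t. inverse (f' t))"
      using f' nz by (rule times_diff_inverse)
    moreover have "?g ` f ` I \<subseteq> I"
      by (simp add: inv_into_into image_subset_iff)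
    ultimately have "times_diff n (f ` I) (\<lambda>s. inverse (f' (?g s)))"
      using Suc by (intro times_diff_compose[of n I "\<lambda>t. inverse (f' t)" "f ` I" ?g])
    with D show ?case
      by (rule times_diffI)
  qed simp
qed

section \<open>Smoothness in terms of iterated derivatives\<close>

text \<open>A connected set with two points has no isolated point. This makes derivatives within
  \<open>I\<close> unique, also at endpoints.\<close>

lemma at_within_interval_neq_bot:
  assumes "nondegenerate_interval I" "t \<in> I"
  shows "at t within I \<noteq> bot"
proof -
  obtain a b where ab: "is_interval I" "a \<in> I" "b \<in> I" "a < b"
    using assms by (auto simp: nondegenerate_interval_def)
  have "t islimpt I"
    using ab assms(2) connected_imp_perfect is_interval_connected
    by (metis order_less_irrefl singletonD)
  then show ?thesis
    by (simp add: trivial_limit_within)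
qed

lemma deriv_on_eqI:
  assumes "nondegenerate_interval I" "t \<in> I" "(f has_vector_derivative f') (at t within I)"
  shows "deriv_on I f t = f'"
  unfolding deriv_on_def
  by (rule vector_derivative_within[OF at_within_interval_neq_bot[OF assms(1,2)] assms(3)])

lemma smooth_on_has_vector_derivative:
  assumes "smooth_on I f" "t \<in> I"
  shows "(f has_vector_derivative deriv_on I f t) (at t within I)"
proof -
  have "f differentiable (at t within I)"
    using assms by (auto simp: smooth_on_def differentiable_on_def dest: spec[of _ 0])
  then show ?thesis
    by (simp add: deriv_on_def vector_derivative_works)
qed

lemma smooth_on_deriv_on: "smooth_on I f \<Longrightarrow> smooth_on I (deriv_on I f)"
  unfolding smooth_on_def by (metis funpow_Suc_right o_apply)

text \<open>A bounded linear map commutes with differentiation. It is applied with \<open>L\<close>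
  a coordinate of the plane and with \<open>L\<close> the identity.\<close>

lemma smooth_on_imp_times_diff:
  assumes "bounded_linear L"
  shows "smooth_on I f \<Longrightarrow> times_diff n I (\<lambda>t. L (f t))"
proof (induction n arbitrary: f)
  case (Suc n)
  show ?case
  proof (rule times_diffI)
    show "((\<lambda>t. L (f t)) has_real_derivative L (deriv_on I f t)) (at t within I)" if "t \<in> I" for t
      using bounded_linear.has_vector_derivative[OF assms
          smooth_on_has_vector_derivative[OF Suc.prems that]]
      by (simp add: has_real_derivative_iff_has_vector_derivative)
    show "times_diff n I (\<lambda>t. L (deriv_on I f t))"
      using Suc smooth_on_deriv_on by blast
  qed
qed simp

lemma smooth_on_real_iff:
  assumes I: "nondegenerate_interval I"
  shows "smooth_on I f \<longleftrightarrow> (\<forall>n. times_diff n I f)"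
proof
  assume "smooth_on I f"
  then show "\<forall>n. times_diff n I f"
    using smooth_on_imp_times_diff[OF bounded_linear_ident] by blast
next
  assume *: "\<forall>n. times_diff n I f"
  \<comment> \<open>The \<open>n\<close>-th iterated derivative must itself be differentiable, which
    takes \<open>n + 1\<close> orders.\<close>
  have "(deriv_on I ^^ n) f differentiable_on I" if "times_diff (Suc n) I f" for n
    using that
  proof (induction n arbitrary: f)
    case 0
    then show ?case
      by (auto simp: differentiable_on_def real_differentiable_def)
  next
    case (Suc n)
    then obtain f' where f': "\<forall>t\<in>I. (f has_real_derivative f' t) (at t within I)"
      "times_diff (Suc n) I f'"
      by (metis times_diff.simps(2))
    have "times_diff (Suc n) I (deriv_on I f)"
    proof (rule times_diff_cong[OF f'(2)])
      show "f' t = deriv_on I f t" if "t \<in> I" for t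
        using deriv_on_eqI[OF I that, of f "f' t"] f'(1) that
        by (simp add: has_real_derivative_iff_has_vector_derivative)
    qed
    from Suc.IH[OF this] show ?case
      by (simp only: funpow_Suc_right o_apply)
  qed
  with * show "smooth_on I f"
    by (simp add: smooth_on_def)
qed

section \<open>Antiderivatives and diffeomorphisms on intervals\<close>

text \<open>The integral from a fixed base point \<open>m\<close> works. The fundamental theorem is
  applied on a compact interval, whereas \<open>I\<close> may be open or unbounded, so for each
  \<open>t\<close> a compact subinterval is chosen that contains \<open>m\<close> and
  \<open>t\<close> and coincides with \<open>I\<close> near \<open>t\<close>.\<close>

lemma antiderivative_on_interval:
  fixes f :: "real \<Rightarrow> real"
  assumes I: "nondegenerate_interval I" and "continuous_on I f"
  obtains F where "\<And>t. t \<in> I \<Longrightarrow> (F has_real_derivative f t) (at t within I)"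
proof -
  obtain m where m: "m \<in> I"
    using I by (auto simp: nondegenerate_interval_def)
  have conv: "{x..y} \<subseteq> I" if "x \<in> I" "y \<in> I" for x y
  proof -
    have "is_interval I"
      using I by (simp add: nondegenerate_interval_def)
    from mem_is_interval_1_I[OF this that] show ?thesis
      by auto
  qed
  define F where "F = (\<lambda>u. LBINT y=ereal m..ereal u. f y)"
  have "(F has_real_derivative f t) (at t within I)" if t: "t \<in> I" for t
  proof -
    \<comment> \<open>The last property says that \<open>a\<close> lies strictly below
      \<open>t\<close> unless no point of \<open>I\<close> lies below \<open>a\<close>;
      \<open>b\<close> is its mirror image.\<close>
    obtain a where a: "a \<in> I" "a \<le> m" "a \<le> t" "\<And>s. s \<in> I \<Longrightarrow> s < a \<Longrightarrow> a < t"
    proof (cases "\<exists>s\<in>I. s < t")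
      case True
      then obtain s where "s \<in> I" "s < t" by blast
      then show ?thesis
        using that[of "min s m"] m by (auto simp: min_def)
    next
      case False
      then show ?thesis
        using that[of t] m t by force
    qed
    obtain b where b: "b \<in> I" "m \<le> b" "t \<le> b" "\<And>s. s \<in> I \<Longrightarrow> b < s \<Longrightarrow> t < b"
    proof (cases "\<exists>s\<in>I. t < s")
      case True
      then obtain s where "s \<in> I" "t < s" by blast
      then show ?thesis
        using that[of "max s m"] m by (auto simp: max_def)
    next
      case False
      then show ?thesis
        using that[of t] m t by force
    qed
    have "(F has_vector_derivative f t) (at t within {a..b})"
      unfolding F_def using a b conv[OF a(1) b(1)] assms(2)
      by (intro interval_integral_FTC2) (auto intro: continuous_on_subset)
    moreover
    \<comment> \<open>\<open>S\<close> is an open neighbourhood of \<open>t\<close> in which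
      \<open>I\<close> and \<open>{a..b}\<close> have the same points. The bounds
      \<open>t - 1\<close> and \<open>t + 1\<close> serve when \<open>t\<close> is itself an
      endpoint.\<close>
    define S where "S = {(if a < t then a else t - 1)<..<(if t < b then b else t + 1)}"
    have "at t within {a..b} = at t within I"
    proof (rule at_within_nhd[of t S])
      have "x \<in> {a..b}" if "x \<in> I" "x \<in> S" for x
      proof -
        have "a \<le> x"
          using a(4)[OF that(1)] that(2) by (cases "a < t"; cases "x < a") (auto simp: S_def)
        moreover have "x \<le> b"
          using b(4)[OF that(1)] that(2) by (cases "t < b"; cases "b < x") (auto simp: S_def)
        ultimately show ?thesis
          by simp
      qed
      then show "{a..b} \<inter> S - {t} = I \<inter> S - {t}"
        using conv[OF a(1) b(1)] by blast
    qed (auto simp: S_def)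
    ultimately show ?thesis
      by (simp add: has_real_derivative_iff_has_vector_derivative)
  qed
  then show ?thesis
    using that by blast
qed

lemma has_zero_derivative_on_interval:
  fixes f :: "real \<Rightarrow> real"
  assumes "is_interval I" "\<And>t. t \<in> I \<Longrightarrow> (f has_real_derivative 0) (at t within I)"
  obtains k where "\<And>t. t \<in> I \<Longrightarrow> f t = k"
  using has_field_derivative_zero_constant[of I f] assms is_interval_convex by blast

text \<open>By the mean value theorem, two equal values would force a zero of \<open>f'\<close>
  between them.\<close>

lemma inj_on_interval_of_derivative_nonzero:
  fixes f :: "real \<Rightarrow> real"
  assumes I: "is_interval I"
    and d: "\<And>t. t \<in> I \<Longrightarrow> (f has_real_derivative f' t) (at t within I)"
    and nz: "\<And>t. t \<in> I \<Longrightarrow> f' t \<noteq> 0"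
  shows "inj_on f I"
proof (rule linorder_inj_onI')
  fix s t assume st: "s \<in> I" "t \<in> I" "s < t"
  then have sub: "{s..t} \<subseteq> I"
    using mem_is_interval_1_I[OF I st(1,2)] by auto
  have "(f has_derivative (*) (f' x)) (at x within {s..t})" if "s \<le> x" "x \<le> t" for x
    using DERIV_subset[OF d sub] that sub by (auto simp: has_field_derivative_def)
  then have "\<exists>x\<in>{s<..<t}. f t - f s = f' x * (t - s)"
    by (rule mvt_simple[OF st(3)])
  then obtain x where "s < x" "x < t" "f t - f s = f' x * (t - s)"
    by auto
  moreover from this have "f' x \<noteq> 0"
    using sub by (intro nz) auto
  ultimately show "f s \<noteq> f t"
    by auto
qed

text \<open>Provides the change of parameter for \<open>admits_parametrization\<close>; it will be
  applied to the tangent angle, whose derivative is smooth and has no zero.\<close>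

lemma diffeo_between_image:
  assumes I: "nondegenerate_interval I"
    and d: "\<And>t. t \<in> I \<Longrightarrow> (f has_real_derivative f' t) (at t within I)"
    and f': "\<And>n. times_diff n I f'" and nz: "\<And>t. t \<in> I \<Longrightarrow> f' t \<noteq> 0"
  shows "nondegenerate_interval (f ` I)" "diffeo_between I (f ` I) f"
proof -
  have ii: "is_interval I"
    using I by (simp add: nondegenerate_interval_def)
  have inj: "inj_on f I"
    using inj_on_interval_of_derivative_nonzero[OF ii d nz] .
  have "continuous_on I f"
    by (rule DERIV_continuous_on[OF d])
  then have "is_interval (f ` I)"
    using ii connected_continuous_image is_interval_connected_1 by blast
  moreover obtain a b where "a \<in> I" "b \<in> I" "a \<noteq> b"
    using I by (auto simp: nondegenerate_interval_def)
  then have "f a < f b \<or> f b < f a"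
    using inj by (meson inj_onD linorder_less_linear)
  ultimately show J: "nondegenerate_interval (f ` I)"
    using \<open>a \<in> I\<close> \<open>b \<in> I\<close> by (auto simp: nondegenerate_interval_def)
  have "times_diff n I f" for n
    using times_diff_Suc_D[OF times_diffI[OF d f']] .
  then show "diffeo_between I (f ` I) f"
    using inj times_diff_inv_into[OF d f' nz ii inj] J I
    by (simp add: diffeo_between_def smooth_on_real_iff inj_on_imp_bij_betw)
qed

section \<open>The tangent angle of a soliton\<close>

text \<open>An antiderivative of \<open>\<omega>\<close>, shifted to give the right angle at one
  point \<open>m\<close>, is the angle everywhere: (a, b) and (cos \<phi>, sin \<phi>) both rotate
  at speed \<open>\<omega>\<close> and agree at \<open>m\<close>.\<close>

lemma angle_function:
  fixes a b \<omega> :: "real \<Rightarrow> real"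
  assumes I: "nondegenerate_interval I" and \<omega>: "continuous_on I \<omega>"
    and unit: "\<And>t. t \<in> I \<Longrightarrow> (a t)\<^sup>2 + (b t)\<^sup>2 = 1"
    and a': "\<And>t. t \<in> I \<Longrightarrow> (a has_real_derivative - \<omega> t * b t) (at t within I)"
    and b': "\<And>t. t \<in> I \<Longrightarrow> (b has_real_derivative \<omega> t * a t) (at t within I)"
  obtains \<phi> where "\<And>t. t \<in> I \<Longrightarrow> (\<phi> has_real_derivative \<omega> t) (at t within I)"
    "\<And>t. t \<in> I \<Longrightarrow> a t = cos (\<phi> t)" "\<And>t. t \<in> I \<Longrightarrow> b t = sin (\<phi> t)"
proof -
  obtain F where F: "\<And>t. t \<in> I \<Longrightarrow> (F has_real_derivative \<omega> t) (at t within I)"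
    using antiderivative_on_interval[OF I \<omega>] by blast
  have ii: "is_interval I"
    using I by (simp add: nondegenerate_interval_def)
  obtain m where m: "m \<in> I"
    using I by (auto simp: nondegenerate_interval_def)
  obtain \<theta> where \<theta>: "a m = cos \<theta>" "b m = sin \<theta>"
    using sincos_total_2pi[OF unit[OF m]] by metis
  define \<phi> where "\<phi> = (\<lambda>t. F t - F m + \<theta>)"
  have \<phi>m: "\<phi> m = \<theta>"
    by (simp add: \<phi>_def)
  have \<phi>': "(\<phi> has_real_derivative \<omega> t) (at t within I)" if "t \<in> I" for t
    unfolding \<phi>_def using F[OF that] by (auto intro!: derivative_eq_intros)

  \<comment> \<open>This quantity and the next, \<open>k\<close> and \<open>l\<close>, are the
    cosine and sine of the angle between the two unit vectors. Both are constant, and their values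
    at \<open>m\<close> are 1 and 0.\<close>
  have "((\<lambda>t. a t * cos (\<phi> t) + b t * sin (\<phi> t)) has_real_derivative 0) (at t within I)"
    if "t \<in> I" for t
    using that by (auto intro!: derivative_eq_intros a' b' \<phi>' simp: algebra_simps)
  then obtain k where k: "\<And>t. t \<in> I \<Longrightarrow> a t * cos (\<phi> t) + b t * sin (\<phi> t) = k"
    using has_zero_derivative_on_interval[OF ii] by blast
  have "((\<lambda>t. b t * cos (\<phi> t) - a t * sin (\<phi> t)) has_real_derivative 0) (at t within I)"
    if "t \<in> I" for t
    using that by (auto intro!: derivative_eq_intros a' b' \<phi>' simp: algebra_simps)
  then obtain l where l: "\<And>t. t \<in> I \<Longrightarrow> b t * cos (\<phi> t) - a t * sin (\<phi> t) = l"
    using has_zero_derivative_on_interval[OF ii] by blast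
  have kl: "k = 1" "l = 0"
    using k[OF m] l[OF m] by (auto simp: \<phi>m \<theta> simp flip: power2_eq_square)
  have ab: "a t = cos (\<phi> t) \<and> b t = sin (\<phi> t)" if "t \<in> I" for t
  proof -
    have sc: "sin (\<phi> t) * sin (\<phi> t) + cos (\<phi> t) * cos (\<phi> t) = 1"
      by (simp flip: power2_eq_square)
    show ?thesis
      using k[OF that] l[OF that] sc unfolding kl by algebra
  qed
  show ?thesis
    using that[OF \<phi>'] ab by blast
qed

text \<open>Here \<open>p\<close> and \<open>q\<close> are the normal and tangential components of the position vector and
  \<open>\<phi>\<close> is the tangent angle.\<close>

lemma homothetic_soliton_support_equations:
  assumes sol: "homothetic_soliton c I X"
  obtains \<phi> \<omega> p q :: "real \<Rightarrow> real" where
    "\<And>t. t \<in> I \<Longrightarrow> (\<phi> has_real_derivative \<omega> t) (at t within I)"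
    "\<And>n. times_diff n I \<omega>"
    "\<And>t. t \<in> I \<Longrightarrow> \<omega> t \<noteq> 0"
    "\<And>t. t \<in> I \<Longrightarrow> (p has_real_derivative - \<omega> t * q t) (at t within I)"
    "\<And>t. t \<in> I \<Longrightarrow> (q has_real_derivative (1 - c) * \<omega> t * p t) (at t within I)"
    "\<And>t. t \<in> I \<Longrightarrow> X t = vector [q t * cos (\<phi> t) - p t * sin (\<phi> t), q t * sin (\<phi> t) + p t * cos (\<phi> t)]"
proof -
  have I: "nondegenerate_interval I" and sX: "smooth_on I X"
    and reg: "\<And>t. t \<in> I \<Longrightarrow> deriv_on I X t \<noteq> 0"
    and \<kappa>nz: "\<And>t. t \<in> I \<Longrightarrow> curvature_vector I X t \<noteq> 0"
    and eq: "\<And>t. t \<in> I \<Longrightarrow> - ((1 / (norm (curvature_vector I X t))\<^sup>2) *\<^sub>R curvature_vector I X t)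
             = c *\<^sub>R normal_component I X t"
    using sol by (auto simp: homothetic_soliton_def regular_curve_def)
  define X1 where "X1 = deriv_on I X"
  define X2 where "X2 = deriv_on I X1"
  have s1: "smooth_on I X1" and s2: "smooth_on I X2"
    using sX by (simp_all add: X1_def X2_def smooth_on_deriv_on)
  define x y x1 y1 x2 y2 where comps: "x = (\<lambda>t. X t $ 1)" "y = (\<lambda>t. X t $ 2)"
    "x1 = (\<lambda>t. X1 t $ 1)" "y1 = (\<lambda>t. X1 t $ 2)" "x2 = (\<lambda>t. X2 t $ 1)" "y2 = (\<lambda>t. X2 t $ 2)"
  have td: "times_diff n I x1" "times_diff n I y1" "times_diff n I x2" "times_diff n I y2" for n
    unfolding comps
    by (intro smooth_on_imp_times_diff[OF bounded_linear_vec_nth] s1 s2)+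
  have d: "(x has_real_derivative x1 t) (at t within I)" "(y has_real_derivative y1 t) (at t within I)"
    "(x1 has_real_derivative x2 t) (at t within I)" "(y1 has_real_derivative y2 t) (at t within I)"
    if "t \<in> I" for t
    using smooth_on_has_vector_derivative[OF sX that] smooth_on_has_vector_derivative[OF s1 that]
    unfolding comps has_real_derivative_iff_has_vector_derivative X2_def
    by (auto intro!: bounded_linear.has_vector_derivative[OF bounded_linear_vec_nth] simp: X1_def)
  \<comment> \<open>\<open>v\<close> is the speed and \<open>w\<close> its square; \<open>w\<close>
    is kept apart because it is polynomial in the derivatives of the coordinates.\<close>
  define w where "w = (\<lambda>t. x1 t * x1 t + y1 t * y1 t)"
  define v where "v = (\<lambda>t. sqrt (w t))"
  have wpos: "w t > 0" if "t \<in> I" for t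
  proof -
    have "x1 t \<noteq> 0 \<or> y1 t \<noteq> 0"
      using reg[OF that] by (auto simp: comps X1_def vec_eq_iff forall_2)
    then show ?thesis
      by (auto simp: w_def sum_squares_gt_zero_iff)
  qed
  have vpos: "v t > 0" and vv: "v t * v t = w t" if "t \<in> I" for t
    using wpos[OF that] by (auto simp: v_def)
  have normX1: "norm (deriv_on I X t) = v t" for t
    by (simp add: norm_eq_sqrt_inner inner_vec_def sum_2 v_def w_def comps X1_def)
  \<comment> \<open>This is det(X', X'') / |X'|^2, the signed curvature times the speed. Sums,
    negation and \<open>inverse\<close> are written out so that the closure rules of
    \<open>times_diff\<close> apply.\<close>
  define \<omega> where "\<omega> = (\<lambda>t. (x1 t * y2 t + - (y1 t * x2 t)) * inverse (w t))"
  have \<omega>td: "times_diff n I \<omega>" for n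
    unfolding \<omega>_def
  proof (intro times_diff_mult times_diff_add times_diff_minus times_diff_inverse td)
    show "times_diff n I w" for n
      unfolding w_def by (intro times_diff_mult times_diff_add td)
    show "w t \<noteq> 0" if "t \<in> I" for t
      using wpos[OF that] by simp
  qed
  \<comment> \<open>(a, b) is the unit tangent, hence (-b, a) is the unit normal.\<close>
  define a b where "a = (\<lambda>t. x1 t / v t)" and "b = (\<lambda>t. y1 t / v t)"
  have v': "(v has_real_derivative (x1 t * x2 t + y1 t * y2 t) / v t) (at t within I)"
    if "t \<in> I" for t
  proof -
    have "(w has_real_derivative 2 * (x1 t * x2 t + y1 t * y2 t)) (at t within I)"
      unfolding w_def
      by (rule derivative_eq_intros d[OF that] refl)+ (simp add: algebra_simps)
    then show ?thesis
      unfolding v_def using wpos[OF that]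
      by (auto intro!: derivative_eq_intros simp: divide_simps)
  qed
  have unit: "(a t)\<^sup>2 + (b t)\<^sup>2 = 1" if "t \<in> I" for t
  proof -
    have "(a t)\<^sup>2 + (b t)\<^sup>2 = w t / (v t * v t)"
      by (simp add: a_def b_def w_def power2_eq_square add_divide_distrib)
    then show ?thesis
      using wpos[OF that] by (simp add: vv[OF that])
  qed
  have x1: "x1 t = v t * a t" and y1: "y1 t = v t * b t" if "t \<in> I" for t
    using vpos[OF that] by (auto simp: a_def b_def)
  have a': "(a has_real_derivative - \<omega> t * b t) (at t within I)" if "t \<in> I" for t
  proof -
    have "(a has_real_derivative
        (x2 t * v t - x1 t * ((x1 t * x2 t + y1 t * y2 t) / v t)) / (v t * v t)) (at t within I)"
      unfolding a_def using d[OF that] v'[OF that] vpos[OF that]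
      by (auto intro!: derivative_eq_intros)
    \<comment> \<open>Clearing the inner fraction brings out \<open>v t * v t\<close>, which is then
      replaced by \<open>w t\<close> to remove the square root.\<close>
    also have "(x2 t * v t - x1 t * ((x1 t * x2 t + y1 t * y2 t) / v t)) / (v t * v t)
      = (x2 t * (v t * v t) - x1 t * (x1 t * x2 t + y1 t * y2 t)) / (v t * v t * v t)"
      using vpos[OF that] by (simp add: field_simps)
    also have "\<dots> = - \<omega> t * b t"
      using vpos[OF that] wpos[OF that] unfolding vv[OF that]
      by (simp add: \<omega>_def b_def divide_simps) (simp add: w_def algebra_simps)
    finally show ?thesis .
  qed
  have b': "(b has_real_derivative \<omega> t * a t) (at t within I)" if "t \<in> I" for t
  proof -
    have "(b has_real_derivative
        (y2 t * v t - y1 t * ((x1 t * x2 t + y1 t * y2 t) / v t)) / (v t * v t)) (at t within I)"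
      unfolding b_def using d[OF that] v'[OF that] vpos[OF that]
      by (auto intro!: derivative_eq_intros)
    also have "(y2 t * v t - y1 t * ((x1 t * x2 t + y1 t * y2 t) / v t)) / (v t * v t)
      = (y2 t * (v t * v t) - y1 t * (x1 t * x2 t + y1 t * y2 t)) / (v t * v t * v t)"
      using vpos[OF that] by (simp add: field_simps)
    also have "\<dots> = \<omega> t * a t"
      using vpos[OF that] wpos[OF that] unfolding vv[OF that]
      by (simp add: \<omega>_def a_def divide_simps) (simp add: w_def algebra_simps)
    finally show ?thesis .
  qed
  have T: "unit_tangent I X t = vector [a t, b t]" if "t \<in> I" for t
    using vpos[OF that]
    by (simp add: unit_tangent_def arclength_deriv_def normX1 vec_eq_iff forall_2 a_def b_def
        comps X1_def)
  have T': "deriv_on I (arclength_deriv I X X) t = vector [- \<omega> t * b t, \<omega> t * a t]"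
    if "t \<in> I" for t
  proof (rule deriv_on_eqI[OF I that])
    \<comment> \<open>Expanding in the standard basis reduces the vector derivative to the real
      derivatives of \<open>a\<close> and \<open>b\<close>.\<close>
    have e: "arclength_deriv I X X = (\<lambda>t. \<Sum>i\<in>UNIV. (if i = 1 then a t else b t) *\<^sub>R axis i 1)"
      by (simp add: fun_eq_iff arclength_deriv_def normX1 vec_eq_iff forall_2 a_def b_def
        comps X1_def sum_2 axis_def)
    show "(arclength_deriv I X X has_vector_derivative vector [- \<omega> t * b t, \<omega> t * a t]) (at t within I)"
      unfolding e sum_2 using a'[OF that] b'[OF that]
      by (auto intro!: derivative_eq_intros simp: vec_eq_iff forall_2 axis_def
          has_real_derivative_iff_has_vector_derivative)
  qed
  have \<kappa>: "curvature_vector I X t = (\<omega> t / v t) *\<^sub>R vector [- b t, a t]" if "t \<in> I" for t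
    by (simp add: curvature_vector_def arclength_deriv_def[of I X "arclength_deriv I X X"]
        normX1 T'[OF that] vec_eq_iff forall_2)
  have \<omega>nz: "\<omega> t \<noteq> 0" if "t \<in> I" for t
    using \<kappa>nz[OF that] \<kappa>[OF that] by auto
  define p q where "p = (\<lambda>t. a t * y t - b t * x t)" and "q = (\<lambda>t. a t * x t + b t * y t)"
  \<comment> \<open>The curvature vector is (\<omega>/v) N with N the unit normal, so dividing it by
    its squared norm gives (v/\<omega>) N. Pairing the soliton equation with N removes the
    tangential part of X and leaves -v/\<omega> = c p.\<close>
  have v_eq: "v t = - c * p t * \<omega> t" if t: "t \<in> I" for t
  proof -
    define N where "N = (vector [- b t, a t] :: real^2)"
    have NN: "N \<bullet> N = 1" and NT: "unit_tangent I X t \<bullet> N = 0" and NX: "X t \<bullet> N = p t"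
      using unit[OF t]
      by (simp_all add: N_def T[OF t] inner_vec_def sum_2 p_def comps power2_eq_square)
    have "(norm (curvature_vector I X t))\<^sup>2 = (\<omega> t / v t)\<^sup>2"
      using NN by (simp add: \<kappa>[OF t] norm_eq_sqrt_inner power2_eq_square flip: N_def)
    then have "- ((v t / \<omega> t) *\<^sub>R N) = c *\<^sub>R normal_component I X t"
      using eq[OF t] \<omega>nz[OF t] vpos[OF t]
      by (simp add: \<kappa>[OF t] power2_eq_square flip: N_def)
    then have "- ((v t / \<omega> t) *\<^sub>R N) \<bullet> N = c *\<^sub>R normal_component I X t \<bullet> N"
      by simp
    then have "- (v t / \<omega> t) = c * p t"
      by (simp add: NN NT NX normal_component_def inner_diff_left)
    then show ?thesis
      using \<omega>nz[OF t] by (simp add: field_simps)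
  qed
  have p': "(p has_real_derivative - \<omega> t * q t) (at t within I)" if "t \<in> I" for t
    unfolding p_def q_def using d[OF that] a'[OF that] b'[OF that]
    by (auto intro!: derivative_eq_intros simp: x1[OF that] y1[OF that] algebra_simps)
  have q': "(q has_real_derivative (1 - c) * \<omega> t * p t) (at t within I)" if t: "t \<in> I" for t
  proof -
    \<comment> \<open>The Frenet form of the derivative is \<omega> p + v; substituting v = -c p
      \<omega> turns it into (1 - c) \<omega> p.\<close>
    have "(q has_real_derivative \<omega> t * p t + v t * ((a t)\<^sup>2 + (b t)\<^sup>2)) (at t within I)"
      unfolding p_def q_def using d[OF that] a'[OF that] b'[OF that]
      by (auto intro!: derivative_eq_intros
          simp: x1[OF that] y1[OF that] algebra_simps power2_eq_square)
    then show ?thesis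
      unfolding unit[OF t] v_eq[OF t] by (simp add: algebra_simps)
  qed
  have "continuous_on I \<omega>"
    using \<omega>td[of "Suc 0"] DERIV_continuous_on by auto
  then obtain \<phi> where \<phi>: "\<And>t. t \<in> I \<Longrightarrow> (\<phi> has_real_derivative \<omega> t) (at t within I)"
    "\<And>t. t \<in> I \<Longrightarrow> a t = cos (\<phi> t)" "\<And>t. t \<in> I \<Longrightarrow> b t = sin (\<phi> t)"
    using angle_function[OF I _ unit a' b'] by blast
  have X: "X t = vector [q t * cos (\<phi> t) - p t * sin (\<phi> t), q t * sin (\<phi> t) + p t * cos (\<phi> t)]"
    if t: "t \<in> I" for t
  proof -
    have "x t = q t * a t - p t * b t" "y t = q t * b t + p t * a t"
      using unit[OF t] unfolding p_def q_def by algebra+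
    then show ?thesis
      by (simp add: vec_eq_iff forall_2 comps \<phi>(2,3)[OF t])
  qed
  show ?thesis
    by (rule that[OF \<phi>(1) \<omega>td \<omega>nz p' q' X])
qed

section \<open>Integration of the linear system in the three cases\<close>

lemma has_zero_derivatives_on_interval:
  fixes f g :: "real \<Rightarrow> real"
  assumes "nondegenerate_interval I" "\<And>t. t \<in> I \<Longrightarrow> (f has_real_derivative 0) (at t within I)"
    "\<And>t. t \<in> I \<Longrightarrow> (g has_real_derivative 0) (at t within I)"
  obtains k l where "\<And>t. t \<in> I \<Longrightarrow> f t = k" "\<And>t. t \<in> I \<Longrightarrow> g t = l"
  using has_zero_derivative_on_interval[OF _ assms(2)] has_zero_derivative_on_interval[OF _ assms(3)]
    assms(1) unfolding nondegenerate_interval_def by metis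

theorem theorem5:
  fixes c :: real and I :: "real set" and X :: "real \<Rightarrow> real^2"
  assumes "homothetic_soliton c I X"
  shows "\<exists>\<mu>\<^sub>1 \<mu>\<^sub>2 :: real.
    (c < 0 \<or> 0 < c \<and> c < 1 \<longrightarrow>
      (let \<alpha> = sqrt (1 - c) in
        admits_parametrization I X (\<lambda>\<theta>. vector
          [\<alpha> * (\<mu>\<^sub>1 * sin (\<alpha> * \<theta>) - \<mu>\<^sub>2 * cos (\<alpha> * \<theta>)) * cos \<theta>
             - (\<mu>\<^sub>1 * cos (\<alpha> * \<theta>) + \<mu>\<^sub>2 * sin (\<alpha> * \<theta>)) * sin \<theta>,
           \<alpha> * (\<mu>\<^sub>1 * sin (\<alpha> * \<theta>) - \<mu>\<^sub>2 * cos (\<alpha> * \<theta>)) * sin \<theta>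
             + (\<mu>\<^sub>1 * cos (\<alpha> * \<theta>) + \<mu>\<^sub>2 * sin (\<alpha> * \<theta>)) * cos \<theta>]))) \<and>
    (c = 1 \<longrightarrow>
        admits_parametrization I X (\<lambda>\<theta>. vector
          [- \<mu>\<^sub>2 * cos \<theta> - (\<mu>\<^sub>1 + \<mu>\<^sub>2 * \<theta>) * sin \<theta>,
           - \<mu>\<^sub>2 * sin \<theta> + (\<mu>\<^sub>1 + \<mu>\<^sub>2 * \<theta>) * cos \<theta>])) \<and>
    (c > 1 \<longrightarrow>
      (let \<alpha> = sqrt (c - 1) in
        admits_parametrization I X (\<lambda>\<theta>. vector
          [- \<alpha> * (\<mu>\<^sub>1 * sinh (\<alpha> * \<theta>) + \<mu>\<^sub>2 * cosh (\<alpha> * \<theta>)) * cos \<theta>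
             - (\<mu>\<^sub>1 * cosh (\<alpha> * \<theta>) + \<mu>\<^sub>2 * sinh (\<alpha> * \<theta>)) * sin \<theta>,
           - \<alpha> * (\<mu>\<^sub>1 * sinh (\<alpha> * \<theta>) + \<mu>\<^sub>2 * cosh (\<alpha> * \<theta>)) * sin \<theta>
             + (\<mu>\<^sub>1 * cosh (\<alpha> * \<theta>) + \<mu>\<^sub>2 * sinh (\<alpha> * \<theta>)) * cos \<theta>])))"
proof -
  obtain \<phi> \<omega> p q where
    \<phi>': "\<And>t. t \<in> I \<Longrightarrow> (\<phi> has_real_derivative \<omega> t) (at t within I)"
    and \<omega>: "\<And>n. times_diff n I \<omega>" "\<And>t. t \<in> I \<Longrightarrow> \<omega> t \<noteq> 0"
    and p': "\<And>t. t \<in> I \<Longrightarrow> (p has_real_derivative - \<omega> t * q t) (at t within I)"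
    and q': "\<And>t. t \<in> I \<Longrightarrow> (q has_real_derivative (1 - c) * \<omega> t * p t) (at t within I)"
    and X: "\<And>t. t \<in> I \<Longrightarrow>
      X t = vector [q t * cos (\<phi> t) - p t * sin (\<phi> t), q t * sin (\<phi> t) + p t * cos (\<phi> t)]"
    using homothetic_soliton_support_equations[OF assms] by blast
  have I: "nondegenerate_interval I"
    using assms by (simp add: homothetic_soliton_def regular_curve_def)
  \<comment> \<open>The new parameter interval is the image of \<open>I\<close> under
    \<open>\<phi>\<close>. It remains to express \<open>p\<close> and \<open>q\<close> through
    \<open>\<phi>\<close>.\<close>
  have param: "admits_parametrization I X Y" if "\<And>t. t \<in> I \<Longrightarrow> X t = Y (\<phi> t)" for Y
    unfolding admits_parametrization_def
    using diffeo_between_image[OF I \<phi>' \<omega>] that by blast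
  consider "c < 1" | "c = 1" | "c > 1"
    by linarith
  then show ?thesis
  proof cases
    case 1
    define \<alpha> where "\<alpha> = sqrt (1 - c)"
    have \<alpha>: "\<alpha> \<noteq> 0" "1 - c = \<alpha> * \<alpha>"
      using 1 by (auto simp: \<alpha>_def)
    note q2 = q'[unfolded \<alpha>(2)]
    \<comment> \<open>As a function of \<open>\<phi>\<close>, the vector (p, q/\<alpha>) rotates
      with angular speed \<open>\<alpha>\<close>. Rotating it back gives a constant vector; its
      second entry is taken with reversed sign to match the stated formula.\<close>
    have "((\<lambda>t. p t * cos (\<alpha> * \<phi> t) + q t / \<alpha> * sin (\<alpha> * \<phi> t)) has_real_derivative 0) (at t within I)"
      "((\<lambda>t. p t * sin (\<alpha> * \<phi> t) - q t / \<alpha> * cos (\<alpha> * \<phi> t)) has_real_derivative 0) (at t within I)"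
      if "t \<in> I" for t
      using that \<alpha>(1)
      by (auto intro!: derivative_eq_intros p' q2 \<phi>' simp: field_simps)
    then obtain \<mu>1 \<mu>2 where \<mu>:
      "\<And>t. t \<in> I \<Longrightarrow> p t * cos (\<alpha> * \<phi> t) + q t / \<alpha> * sin (\<alpha> * \<phi> t) = \<mu>1"
      "\<And>t. t \<in> I \<Longrightarrow> p t * sin (\<alpha> * \<phi> t) - q t / \<alpha> * cos (\<alpha> * \<phi> t) = \<mu>2"
      using has_zero_derivatives_on_interval[OF I] by blast
    have pq: "p t = \<mu>1 * cos (\<alpha> * \<phi> t) + \<mu>2 * sin (\<alpha> * \<phi> t)"
      "q t = \<alpha> * (\<mu>1 * sin (\<alpha> * \<phi> t) - \<mu>2 * cos (\<alpha> * \<phi> t))" if t: "t \<in> I" for t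
    proof -
      define r where "r = q t / \<alpha>"
      have r: "q t = \<alpha> * r"
        using \<alpha>(1) by (simp add: r_def)
      define C S where CS: "C = cos (\<alpha> * \<phi> t)" "S = sin (\<alpha> * \<phi> t)"
      have sc: "S * S + C * C = 1"
        by (simp add: CS flip: power2_eq_square)
      have eqs: "p t * C + r * S = \<mu>1" "p t * S - r * C = \<mu>2"
        using \<mu>[OF t] by (simp_all add: r_def CS)
      \<comment> \<open>Expanding the factor S^2 + C^2 = 1 and regrouping inverts the
        rotation.\<close>
      have "p t = p t * (S * S + C * C)"
        by (simp add: sc)
      also have "\<dots> = \<mu>1 * C + \<mu>2 * S"
        by (simp add: algebra_simps flip: eqs)
      finally show "p t = \<mu>1 * cos (\<alpha> * \<phi> t) + \<mu>2 * sin (\<alpha> * \<phi> t)"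
        by (simp add: CS)
      have "r = r * (S * S + C * C)"
        by (simp add: sc)
      also have "\<dots> = \<mu>1 * S - \<mu>2 * C"
        by (simp add: algebra_simps flip: eqs)
      finally show "q t = \<alpha> * (\<mu>1 * sin (\<alpha> * \<phi> t) - \<mu>2 * cos (\<alpha> * \<phi> t))"
        by (simp add: CS r)
    qed
    show ?thesis
      using 1
      by (intro exI[of _ \<mu>1] exI[of _ \<mu>2]) (auto simp: Let_def X pq simp flip: \<alpha>_def intro!: param)
  next
    case 2
    \<comment> \<open>For c = 1 the component \<open>q\<close> is constant and dp/d\<phi> = -q, so
      \<open>p\<close> is affine in \<open>\<phi>\<close>.\<close>
    have "((\<lambda>t. p t + q t * \<phi> t) has_real_derivative 0) (at t within I)"
      "((\<lambda>t. - q t) has_real_derivative 0) (at t within I)" if "t \<in> I" for t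
      using that 2 by (auto intro!: derivative_eq_intros p' q' \<phi>')
    then obtain \<mu>1 \<mu>2 where \<mu>:
      "\<And>t. t \<in> I \<Longrightarrow> p t + q t * \<phi> t = \<mu>1" "\<And>t. t \<in> I \<Longrightarrow> - q t = \<mu>2"
      using has_zero_derivatives_on_interval[OF I] by blast
    have pq: "p t = \<mu>1 + \<mu>2 * \<phi> t" "q t = - \<mu>2" if t: "t \<in> I" for t
      using \<mu>[OF t] by (auto simp: algebra_simps)
    show ?thesis
      using 2
      by (intro exI[of _ \<mu>1] exI[of _ \<mu>2]) (auto simp: X pq intro!: param)
  next
    case 3
    define \<alpha> where "\<alpha> = sqrt (c - 1)"
    have "c - 1 = \<alpha> * \<alpha>" and \<alpha>0: "\<alpha> \<noteq> 0"
      using 3 by (auto simp: \<alpha>_def)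
    then have \<alpha>: "1 - c = - \<alpha> * \<alpha>"
      by simp
    note q2 = q'[unfolded \<alpha>]
    \<comment> \<open>Now (p, q/\<alpha>) undergoes a hyperbolic rotation by -\<alpha> \<phi>;
      undoing it gives the constants, again with the second sign reversed.\<close>
    have "((\<lambda>t. p t * cosh (\<alpha> * \<phi> t) + q t / \<alpha> * sinh (\<alpha> * \<phi> t)) has_real_derivative 0) (at t within I)"
      "((\<lambda>t. - p t * sinh (\<alpha> * \<phi> t) - q t / \<alpha> * cosh (\<alpha> * \<phi> t)) has_real_derivative 0) (at t within I)"
      if "t \<in> I" for t
      using that \<alpha>0
      by (auto intro!: derivative_eq_intros p' q2 \<phi>' simp: field_simps)
    then obtain \<mu>1 \<mu>2 where \<mu>:
      "\<And>t. t \<in> I \<Longrightarrow> p t * cosh (\<alpha> * \<phi> t) + q t / \<alpha> * sinh (\<alpha> * \<phi> t) = \<mu>1"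
      "\<And>t. t \<in> I \<Longrightarrow> - p t * sinh (\<alpha> * \<phi> t) - q t / \<alpha> * cosh (\<alpha> * \<phi> t) = \<mu>2"
      using has_zero_derivatives_on_interval[OF I] by blast
    have pq: "p t = \<mu>1 * cosh (\<alpha> * \<phi> t) + \<mu>2 * sinh (\<alpha> * \<phi> t)"
      "q t = - \<alpha> * (\<mu>1 * sinh (\<alpha> * \<phi> t) + \<mu>2 * cosh (\<alpha> * \<phi> t))" if t: "t \<in> I" for t
    proof -
      define r where "r = q t / \<alpha>"
      have r: "q t = \<alpha> * r"
        using \<alpha>0 by (simp add: r_def)
      define C S where CS: "C = cosh (\<alpha> * \<phi> t)" "S = sinh (\<alpha> * \<phi> t)"
      have sc: "C * C = S * S + 1"
        using cosh_square_eq[of "\<alpha> * \<phi> t"] by (simp add: CS power2_eq_square)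
      have eqs: "p t * C + r * S = \<mu>1" "- p t * S - r * C = \<mu>2"
        using \<mu>[OF t] by (simp_all add: r_def CS)
      \<comment> \<open>The factor C^2 - S^2 = 1 plays the part that S^2 + C^2 has in the
        trigonometric case.\<close>
      have "p t = p t * (C * C - S * S)"
        by (simp add: sc)
      also have "\<dots> = \<mu>1 * C + \<mu>2 * S"
        by (simp add: algebra_simps flip: eqs)
      finally show "p t = \<mu>1 * cosh (\<alpha> * \<phi> t) + \<mu>2 * sinh (\<alpha> * \<phi> t)"
        by (simp add: CS)
      have "r = r * (C * C - S * S)"
        by (simp add: sc)
      also have "\<dots> = - (\<mu>1 * S + \<mu>2 * C)"
        by (simp add: algebra_simps flip: eqs)
      finally show "q t = - \<alpha> * (\<mu>1 * sinh (\<alpha> * \<phi> t) + \<mu>2 * cosh (\<alpha> * \<phi> t))"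
        by (simp only: CS r mult_minus_left mult_minus_right)
    qed
    show ?thesis
      using 3
      by (intro exI[of _ \<mu>1] exI[of _ \<mu>2]) (auto simp: Let_def X pq simp flip: \<alpha>_def intro!: param)
  qed
qed

end
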